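(* Let $B>3$ be an odd integer, and let $K_B\colon X_B\to X_B$ be the four-digit Kaprekar map in difference coordinates. Then: (1) $K_B(\mathcal{T}_B)\subseteq \mathcal{T}_B$ and $K_B^3(X_B)\subseteq \mathcal{T}_B$, where $K_B^3=K_B\circ K_B\circ K_B$. (2) The restricted map $K_B\colon \mathcal{T}_B\to\mathcal{T}_B$ is conjugate to the doubling map $$\delta\colon \binom{P_B}{2}\to\binom{P_B}{2},\qquad \{[r],[s]\}\longmapsto\{[2r],[2s]\},$$ under the transformation $$\Phi\colon \mathcal{T}_B\to\binom{P_B}{2},\qquad (d_1,d_2)\longmapsto \left\{\left[\frac{d_1+d_2}{2}\right],\left[\frac{d_1-d_2}{2}\right]\right\}.$$ That is, $\Phi$ is a well-defined bijection and $\Phi(K_B(d_1,d_2))=\delta(\Phi(d_1,d_2))$ for all $(d_1,d_2)\in\mathcal{T}_B$.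
   Context: State space: $X_B=\{(d_1,d_2)\in\mathbb{Z}^2 : 1\le d_1<B,\ 0\le d_2\le d_1\}$. Stable region: $\mathcal{T}_B=\{(d_1,d_2)\in X_B : d_1>d_2>0,\ d_1\text{ and }d_2\text{ both odd}\}$. Kaprekar routine: a four-digit string in base $B$ is a sequence of four digits in $\{0,\dots,B-1\}$ (leading zeros allowed). Given such a string, not all digits equal, with digits sorted as $a_1\ge a_2\ge a_3\ge a_4$, its difference pair is $(d_1,d_2)=(a_1-a_4,\ a_2-a_3)\in X_B$. One Kaprekar step replaces it by the four-digit base-$B$ string (with leading zeros if needed) of the number $$(a_1B^3+a_2B^2+a_3B+a_4)-(a_4B^3+a_3B^2+a_2B+a_1)=d_1(B^3-1)+d_2(B^2-B),$$ which depends only on $(d_1,d_2)$. The map $K_B\colon X_B\to X_B$ sends $(d_1,d_2)$ to the difference pair of the resulting string. Explicitly, the (unsorted) digits of the resulting string are $[d_1,\ d_2-1,\ B-d_2-1,\ B-d_1]$ if $d_2>0$, and $[d_1-1,\ B-1,\ B-1,\ B-d_1]$ if $d_2=0$; $K_B(d_1,d_2)$ is obtained by sorting these four digits as $a_1'\ge a_2'\ge a_3'\ge a_4'$ and taking $(a_1'-a_4',\ a_2'-a_3')$. Projective classes: $P_B=\bigl((\mathbb{Z}/B\mathbb{Z})\setminus\{0\}\bigr)/\{\pm1\}$; for nonzero $x\in\mathbb{Z}/B\mathbb{Z}$, $[x]=\{x,-x\}\in P_B$ (integers not divisible by $B$ are reduced modulo $B$). $\binom{P_B}{2}$ is the set of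 unordered two-element subsets of $P_B$. *)

theory Defs
  imports "HOL-Number_Theory.Residues" "HOL-Library.Ramsey"
begin

subsection \<open>The Kaprekar routine on four-digit strings\<close>

text \<open>A four-digit string is a list of four integers in \<open>{0..<B}\<close>, most significant digit first.\<close>

definition digit_strings :: "int \<Rightarrow> int list set" where
  "digit_strings B = {s. length s = 4 \<and> set s \<subseteq> {0..<B}}"

definition string_value :: "int \<Rightarrow> int list \<Rightarrow> int" where
  "string_value B s = s!0 * B^3 + s!1 * B^2 + s!2 * B + s!3"

definition digits4 :: "int \<Rightarrow> int \<Rightarrow> int list" where
  "digits4 B n = [n div B^3 mod B, n div B^2 mod B, n div B mod B, n mod B]"

definition diff_pair :: "int list \<Rightarrow> int \<times> int" where
  "diff_pair s = (let a = rev (sort s) in (a!0 - a!3, a!1 - a!2))"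

definition kaprekar_step :: "int \<Rightarrow> int list \<Rightarrow> int list" where
  "kaprekar_step B s = digits4 B (string_value B (rev (sort s)) - string_value B (sort s))"


subsection \<open>The map in difference coordinates\<close>

definition X :: "int \<Rightarrow> (int \<times> int) set" where
  "X B = {(d1, d2). 1 \<le> d1 \<and> d1 < B \<and> 0 \<le> d2 \<and> d2 \<le> d1}"

definition T :: "int \<Rightarrow> (int \<times> int) set" where
  "T B = {(d1, d2) \<in> X B. d1 > d2 \<and> d2 > 0 \<and> odd d1 \<and> odd d2}"

definition K :: "int \<Rightarrow> int \<times> int \<Rightarrow> int \<times> int" where
  "K B = (\<lambda>(d1, d2). diff_pair (digits4 B (d1 * (B^3 - 1) + d2 * (B^2 - B))))"

lemma list4_cases:
  assumes "length s = 4"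
  obtains a b c d where "s = [a, b, c, d]"
  using assms by (auto simp: numeral_eq_Suc length_Suc_conv)

lemma diff_pair_in_X:
  assumes "s \<in> digit_strings B" "\<exists>x\<in>set s. \<exists>y\<in>set s. x \<noteq> y"
  shows "diff_pair s \<in> X B"
proof -
  have "length (sort s) = 4" using assms by (simp add: digit_strings_def)
  then obtain a b c d where s: "sort s = [a, b, c, d]" by (rule list4_cases)
  have st: "set s = {a, b, c, d}" using s by (metis set_sort list.set(1,2))
  have so: "a \<le> b" "b \<le> c" "c \<le> d" using sorted_sort[of s] unfolding s by auto
  have "{a, b, c, d} \<subseteq> {0..<B}" using assms st by (simp add: digit_strings_def)
  moreover have "a \<noteq> d" using so assms(2) st by auto
  ultimately show ?thesis using so by (auto simp: diff_pair_def s X_def)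
qed

lemma diff_pair_kaprekar_step:
  assumes "s \<in> digit_strings B"
  shows "diff_pair (kaprekar_step B s) = K B (diff_pair s)"
proof -
  have "length (sort s) = 4" using assms by (simp add: digit_strings_def)
  then obtain a b c d where s: "sort s = [a, b, c, d]" by (rule list4_cases)
  have "string_value B (rev (sort s)) - string_value B (sort s)
      = (d - a) * (B^3 - 1) + (c - b) * (B^2 - B)"
    by (simp add: s string_value_def algebra_simps)
  then show ?thesis
    by (simp add: kaprekar_step_def K_def diff_pair_def s)
qed

lemma digits4_unique:
  assumes "set [a, b, c, d] \<subseteq> {0..<B}"
  shows "digits4 B (string_value B [a, b, c, d]) = [a, b, c, d]"
proof -
  have r: "0 \<le> a" "a < B" "0 \<le> b" "b < B" "0 \<le> c" "c < B" "0 \<le> d" "d < B"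
    using assms by auto
  define n where "n = string_value B [a, b, c, d]"
  have n: "n = ((a * B + b) * B + c) * B + d"
    by (simp add: n_def string_value_def algebra_simps power2_eq_square power3_eq_cube)
  have step: "(x * B + y) div B = x" "(x * B + y) mod B = y" if "0 \<le> y" "y < B" for x y
    using that by auto
  have 1: "n div B = (a * B + b) * B + c" unfolding n using r by (simp only: step)
  have 2: "n div B^2 = a * B + b"
    using r by (simp add: power2_eq_square zdiv_zmult2_eq 1 step(1))
  have 3: "n div B^3 = a"
  proof -
    have "n div B^3 = n div B^2 div B"
      using r by (simp add: power3_eq_cube power2_eq_square zdiv_zmult2_eq)
    then show ?thesis using r by (simp only: 2 step)
  qed
  have "n mod B = d" unfolding n using r by (simp only: step)
  moreover have "n div B mod B = c" unfolding 1 using r by (simp only: step)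
  moreover have "n div B^2 mod B = b" unfolding 2 using r by (simp only: step)
  ultimately show ?thesis using r 3 by (simp add: digits4_def flip: n_def)
qed

definition K_digits :: "int \<Rightarrow> int \<times> int \<Rightarrow> int list" where
  "K_digits B = (\<lambda>(d1, d2). if d2 > 0 then [d1, d2 - 1, B - d2 - 1, B - d1]
                            else [d1 - 1, B - 1, B - 1, B - d1])"

lemma K_digits_in_strings:
  assumes "p \<in> X B"
  shows "K_digits B p \<in> digit_strings B"
  using assms by (auto simp: X_def K_digits_def digit_strings_def)

lemma K_eq_digits:
  assumes "p \<in> X B"
  shows "K B p = diff_pair (K_digits B p)"
proof -
  obtain d1 d2 where p: "p = (d1, d2)" by (cases p)
  have b: "1 \<le> d1" "d1 < B" "0 \<le> d2" "d2 \<le> d1" using assms by (auto simp: p X_def)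
  have len: "length (K_digits B p) = 4" by (simp add: p K_digits_def)
  then obtain u v w x where s: "K_digits B p = [u, v, w, x]" by (rule list4_cases)
  have "set [u, v, w, x] \<subseteq> {0..<B}"
    using K_digits_in_strings[OF assms] unfolding s by (simp add: digit_strings_def)
  then have "digits4 B (string_value B (K_digits B p)) = K_digits B p"
    unfolding s by (rule digits4_unique)
  moreover have "string_value B (K_digits B p) = d1 * (B^3 - 1) + d2 * (B^2 - B)"
    using b by (auto simp: p K_digits_def string_value_def algebra_simps
        power2_eq_square power3_eq_cube)
  ultimately show ?thesis by (simp add: K_def p)
qed

lemma K_maps_X: "K B ` X B \<subseteq> X B"
proof
  fix q assume "q \<in> K B ` X B"
  then obtain p where p: "p \<in> X B" "q = K B p" by auto
  have "\<exists>x\<in>set (K_digits B p). \<exists>y\<in>set (K_digits B p). x \<noteq> y"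
  proof (cases "snd p > 0")
    case True
    then have "fst p \<in> set (K_digits B p)" "snd p - 1 \<in> set (K_digits B p)"
      by (simp_all add: K_digits_def case_prod_beta)
    moreover have "fst p \<noteq> snd p - 1" using p(1) by (auto simp: X_def)
    ultimately show ?thesis by blast
  next
    case False
    then have "fst p - 1 \<in> set (K_digits B p)" "B - 1 \<in> set (K_digits B p)"
      by (simp_all add: K_digits_def case_prod_beta)
    moreover have "fst p - 1 \<noteq> B - 1" using p(1) by (auto simp: X_def)
    ultimately show ?thesis by blast
  qed
  then show "q \<in> X B"
    using p diff_pair_in_X K_digits_in_strings K_eq_digits by metis
qed


subsection \<open>Projective classes and doubling\<close>

definition pclass :: "int \<Rightarrow> int \<Rightarrow> int set" where
  "pclass B x = {x, \<ominus>\<^bsub>residue_ring B\<^esub> x}"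

definition P :: "int \<Rightarrow> int set set" where
  "P B = pclass B ` (carrier (residue_ring B) - {\<zero>\<^bsub>residue_ring B\<^esub>})"

text \<open>The class \<open>[n]\<close> of an integer, reduced modulo \<open>B\<close>.\<close>

definition iclass :: "int \<Rightarrow> int \<Rightarrow> int set" where
  "iclass B n = pclass B (n mod B)"

text \<open>Doubling is applied elementwise: first to the representatives of a class, then to the
  classes in a pair; \<open>delta_pair\<close> below is the formula in terms of representatives.\<close>

definition delta :: "int \<Rightarrow> int set set \<Rightarrow> int set set" where
  "delta B S = (\<lambda>C. (\<lambda>x. x \<oplus>\<^bsub>residue_ring B\<^esub> x) ` C) ` S"

lemma delta_pair:
  assumes "B > 1"
  shows "delta B {iclass B r, iclass B s} = {iclass B (2 * r), iclass B (2 * s)}"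
proof -
  interpret residues B "residue_ring B" by unfold_locales (use assms in auto)
  have "(\<lambda>x. x \<oplus>\<^bsub>residue_ring B\<^esub> x) ` iclass B n = iclass B (2 * n)" for n
    by (simp add: iclass_def pclass_def res_neg_eq res_add_eq mod_simps)
  then show ?thesis by (simp add: delta_def)
qed

text \<open>On \<open>T B\<close> both coordinates are odd, so both divisions by 2 are exact.\<close>

definition Phi :: "int \<Rightarrow> int \<times> int \<Rightarrow> int set set" where
  "Phi B = (\<lambda>(d1, d2). {iclass B ((d1 + d2) div 2), iclass B ((d1 - d2) div 2)})"

end

theory Submission
  imports Defs
begin

text \<open>For \<open>d2 > 0\<close> the four digits form two complementary pairs, \<open>{d1, B - d1}\<close> with sum \<open>B\<close> and
  \<open>{d2 - 1, B - d2 - 1}\<close> with sum \<open>B - 2\<close>. Hence \<open>K\<close> sorts the two numbers \<open>\<bar>2 d1 - B\<bar>\<close> and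
  \<open>\<bar>2 d2 - B\<bar>\<close>, except when they coincide. Signs and order do not matter for the pair of classes
  of half-sum and half-difference modulo \<open>B\<close>, which turns \<open>K\<close> into doubling.\<close>

section \<open>Closed formulas for one Kaprekar step\<close>

lemma diff_pair_sorted:
  assumes "mset s = {#a, b, c, d#}" "a \<ge> b" "b \<ge> c" "c \<ge> d"
  shows "diff_pair s = (a - d, b - c)"
proof -
  have "sort s = [d, c, b, a]"
    by (rule properties_for_sort) (use assms in auto)
  then show ?thesis by (simp add: diff_pair_def)
qed

text \<open>The complementary digit pairs have differences \<open>u\<close> and \<open>v\<close>,
  but their midpoints \<open>B/2\<close> and \<open>B/2 - 1\<close> are one apart. As intervals they
  are nested when \<open>u \<noteq> v\<close>. When \<open>u = v\<close> they interleave, and the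
  offset of the midpoints produces \<open>u + 1\<close> and \<open>u - 1\<close>.\<close>

lemma K_pos:
  assumes "(d1, d2) \<in> X B" "d2 > 0" "odd B"
  defines "u \<equiv> \<bar>2 * d1 - B\<bar>" and "v \<equiv> \<bar>2 * d2 - B\<bar>"
  shows "K B (d1, d2) = (if u = v then (u + 1, u - 1) else (max u v, min u v))"
proof -
  define a where "a = max d1 (B - d1)"
  define b where "b = max (d2 - 1) (B - d2 - 1)"
  let ?s = "K_digits B (d1, d2)"
  have K: "K B (d1, d2) = diff_pair ?s" using assms(1) by (rule K_eq_digits)
  have s: "mset ?s = {#a, B - a, b, B - 2 - b#}"
    using assms(2) by (auto simp: K_digits_def a_def b_def max_def add_mset_commute)
  have u: "u = 2 * a - B" and v: "v = 2 * b + 2 - B"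
    by (simp_all add: u_def v_def a_def b_def max_def abs_if)
  \<comment> \<open>Both are absolute values of odd numbers. In the interleaved case
    \<open>u > 0\<close> is what gives \<open>b \<ge> B - a\<close>.\<close>
  have "u \<noteq> 0" "v \<noteq> 0" using assms(3) by (auto simp: u_def v_def)
  then have pos: "u > 0" "v > 0" by (auto simp: u_def v_def)
  consider "a \<ge> b + 2" | "a = b + 1" | "a \<le> b" by linarith
  then show ?thesis
  proof cases
    case 1
    have "diff_pair ?s = (a - (B - a), b - (B - 2 - b))"
      by (rule diff_pair_sorted) (use 1 u v pos in \<open>simp_all add: s add_mset_commute\<close>)
    then show ?thesis using K u v 1 by auto
  next
    case 2
    have "diff_pair ?s = (a - (B - 2 - b), b - (B - a))"
      by (rule diff_pair_sorted) (use 2 u v pos in \<open>simp_all add: s add_mset_commute\<close>)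
    then show ?thesis using K u v 2 by auto
  next
    case 3
    have "diff_pair ?s = (b - (B - 2 - b), a - (B - a))"
      by (rule diff_pair_sorted) (use 3 u v pos in \<open>simp_all add: s add_mset_commute\<close>)
    then show ?thesis using K u v 3 by auto
  qed
qed

text \<open>The two digits \<open>B - 1\<close> come first in the sorted order, and the remaining
  two add up to \<open>B - 1\<close>, with \<open>c\<close> the larger.\<close>

lemma K_zero:
  assumes "(d1, 0) \<in> X B"
  defines "c \<equiv> max (d1 - 1) (B - d1)"
  shows "K B (d1, 0) = (c, B - 1 - c)"
proof -
  have b: "1 \<le> d1" "d1 < B" using assms(1) by (auto simp: X_def)
  have "diff_pair (K_digits B (d1, 0)) = (B - 1 - (B - 1 - c), B - 1 - c)"
    by (rule diff_pair_sorted)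
      (use b in \<open>auto simp: K_digits_def c_def max_def add_mset_commute\<close>)
  then show ?thesis using K_eq_digits[OF assms(1)] by simp
qed

section \<open>Invariance of the stable region and entry within three steps\<close>

lemma K_in_T:
  assumes "(d1, d2) \<in> X B" "d2 > 0" "odd B" "d1 \<noteq> d2" "d1 + d2 \<noteq> B"
  shows "K B (d1, d2) \<in> T B"
proof -
  let ?u = "\<bar>2 * d1 - B\<bar>" and ?v = "\<bar>2 * d2 - B\<bar>"
  \<comment> \<open>The excluded lines \<open>d1 = d2\<close> and \<open>d1 + d2 = B\<close> are
    exactly where the two absolute values coincide.\<close>
  have ne: "?u \<noteq> ?v" using assms(4,5) by linarith
  have o: "odd ?u" "odd ?v" using assms(3) by auto
  then have "?u \<noteq> 0" "?v \<noteq> 0" by (metis even_zero)+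
  then have pos: "?u > 0" "?v > 0" by auto
  have "K B (d1, d2) = (max ?u ?v, min ?u ?v)" using K_pos[OF assms(1-3)] ne by simp
  moreover have "K B (d1, d2) \<in> X B" using K_maps_X assms(1) by blast
  ultimately show ?thesis using ne o pos by (auto simp: T_def max_def min_def)
qed

lemma K_T:
  assumes "odd B" "p \<in> T B"
  shows "K B p \<in> T B"
proof -
  obtain d1 d2 where p: "p = (d1, d2)" by (cases p)
  have "(d1, d2) \<in> X B" "d2 > 0" "d1 \<noteq> d2" "d1 + d2 \<noteq> B"
    using assms by (auto simp: p T_def)
  then show ?thesis using K_in_T assms(1) p by blast
qed

lemma K_two_zero:
  assumes "B > 3" "odd B"
  shows "K B (2, 0) \<in> T B"
  using K_zero[of 2 B] assms by (auto simp: X_def T_def)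

text \<open>Off the two exceptional lines one step already reaches \<open>T B\<close>. On them the
  image \<open>(u + 1, u - 1)\<close> has distinct entries and even sum \<open>2 u\<close>, so it
  lies off both lines; only \<open>u = 1\<close> leads to second entry 0, namely to
  \<open>(2, 0)\<close>.\<close>

lemma K_K_pos:
  assumes "B > 3" "odd B" "(d1, d2) \<in> X B" "d2 > 0"
  shows "K B (K B (d1, d2)) \<in> T B"
proof (cases "d1 \<noteq> d2 \<and> d1 + d2 \<noteq> B")
  case True
  then show ?thesis using K_in_T K_T assms by blast
next
  case False
  define u where "u = \<bar>2 * d1 - B\<bar>"
  have "u = \<bar>2 * d2 - B\<bar>" using False by (auto simp: u_def)
  then have K: "K B (d1, d2) = (u + 1, u - 1)"
    using K_pos[OF assms(3,4,2)] by (simp add: u_def)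
  have X: "(u + 1, u - 1) \<in> X B" using K_maps_X assms(3) K by fastforce
  show ?thesis
  proof (cases "u = 1")
    case True
    then show ?thesis using K K_two_zero assms by simp
  next
    case False
    then have "u - 1 > 0" using X by (auto simp: X_def)
    moreover have "(u + 1) + (u - 1) \<noteq> B" using assms(2) by auto
    ultimately show ?thesis using K K_in_T[OF X] assms(2) by simp
  qed
qed

lemma K_cubed_in_T:
  assumes "B > 3" "odd B" "p \<in> X B"
  shows "K B (K B (K B p)) \<in> T B"
proof -
  obtain d1 d2 where p: "p = (d1, d2)" by (cases p)
  show ?thesis
  proof (cases "d2 > 0")
    case True
    then show ?thesis using K_K_pos K_T assms p by blast
  next
    case False
    then have d2: "d2 = 0" using assms(3) by (auto simp: p X_def)
    define c where "c = max (d1 - 1) (B - d1)"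
    have K: "K B p = (c, B - 1 - c)"
      using K_zero[of d1 B] assms(3) by (simp add: p d2 c_def)
    have X: "(c, B - 1 - c) \<in> X B" using K_maps_X assms(3) K by fastforce
    show ?thesis
    \<comment> \<open>This is the only case in which the second coordinate is 0 again after one
      step.\<close>
    proof (cases "c = B - 1")
      case True
      then have "K B (K B p) = (B - 2, 1)" using K K_zero[of c B] X assms(1) by simp
      then have "K B (K B p) \<in> T B" using assms(1,2) by (simp add: X_def T_def)
      then show ?thesis using K_T assms(2) by blast
    next
      case False
      then have "B - 1 - c > 0" using X by (auto simp: X_def)
      then show ?thesis using K K_K_pos[OF assms(1,2) X] by simp
    qed
  qed
qed

section \<open>Projective classes and their representatives\<close>

lemma iclass_eq_iff:
  assumes "B > 1"
  shows "iclass B x = iclass B y \<longleftrightarrow> B dvd x - y \<or> B dvd x + y"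
proof -
  interpret residues B "residue_ring B" by unfold_locales (use assms in auto)
  have *: "iclass B n = {n mod B, - n mod B}" for n
    by (simp add: iclass_def pclass_def res_neg_eq mod_minus_eq)
  have "iclass B x = iclass B y \<longleftrightarrow> x mod B = y mod B \<or> x mod B = - y mod B"
    unfolding * doubleton_eq_iff using mod_minus_cong[of x B y] mod_minus_cong[of x B "- y"] by auto
  then show ?thesis by (simp add: mod_eq_dvd_iff)
qed

lemma iclass_uminus:
  assumes "B > 1"
  shows "iclass B (- x) = iclass B x"
  by (simp add: iclass_eq_iff assms)

text \<open>Here \<open>\<bar>x - y\<bar> < B\<close> and \<open>0 < x + y < 2 B\<close>, so the
  only multiples of \<open>B\<close> available are 0 and \<open>B\<close> respectively.\<close>

lemma iclass_eq_iff_small: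
  assumes "0 < x" "x < B" "0 < y" "y < B"
  shows "iclass B x = iclass B y \<longleftrightarrow> x = y \<or> x + y = B"
proof -
  have "x = y" if "B dvd x - y"
  proof -
    have "\<bar>x - y\<bar> < \<bar>B\<bar>" using assms by linarith
    then show ?thesis using that dvd_imp_le_int[of "x - y" B] by auto
  qed
  then have "B dvd x - y \<longleftrightarrow> x = y" by auto
  moreover have "B dvd x + y \<longleftrightarrow> x + y = B"
  proof
    assume "B dvd x + y"
    then have "B dvd x + y - B" by simp
    then show "x + y = B"
      using assms dvd_imp_le_int[of "x + y - B" B] by fastforce
  qed simp
  ultimately show ?thesis using assms by (simp add: iclass_eq_iff)
qed

text \<open>Since \<open>B\<close> is odd, one of \<open>x\<close> and \<open>B - x\<close> lies
  below \<open>B/2\<close>, and both represent the same class.\<close>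

lemma P_eq:
  assumes "B > 1" "odd B"
  shows "P B = iclass B ` {x. 0 < x \<and> 2 * x < B}"
proof -
  interpret residues B "residue_ring B" by unfold_locales (use assms in auto)
  have "P B = pclass B ` {0<..<B}"
    unfolding P_def by (rule arg_cong[where f = "image _"]) (auto simp: res_carrier_eq res_zero_eq)
  also have "\<dots> = iclass B ` {0<..<B}"
    by (rule image_cong) (auto simp: iclass_def)
  also have "\<dots> = iclass B ` {x. 0 < x \<and> 2 * x < B}"
  proof (intro equalityI subsetI)
    fix C assume "C \<in> iclass B ` {0<..<B}"
    then obtain x where x: "0 < x" "x < B" "C = iclass B x" by auto
    show "C \<in> iclass B ` {x. 0 < x \<and> 2 * x < B}"
    proof (cases "2 * x < B")
      case False
      have "2 * x \<noteq> B" using assms(2) by auto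
      moreover have "C = iclass B (B - x)" using x assms(1) by (simp add: iclass_eq_iff)
      ultimately show ?thesis using x False by auto
    qed (use x in auto)
  qed auto
  finally show ?thesis .
qed

lemma iclass_in_P:
  assumes "B > 1" "odd B" "0 < x" "x < B"
  shows "iclass B x \<in> P B"
proof (cases "2 * x < B")
  case False
  have "2 * x \<noteq> B" using assms(2) by auto
  moreover have "iclass B x = iclass B (B - x)" using assms(1) by (simp add: iclass_eq_iff)
  ultimately show ?thesis using assms False by (auto simp: P_eq)
qed (use assms in \<open>auto simp: P_eq\<close>)

lemma nsets_2_iff: "S \<in> nsets A 2 \<longleftrightarrow> (\<exists>x\<in>A. \<exists>y\<in>A. x \<noteq> y \<and> S = {x, y})"
  by (auto simp: nsets_def card_2_iff)

section \<open>Bijectivity of \<open>Phi\<close>\<close>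

text \<open>Half-sum \<open>r\<close> and half-difference \<open>s\<close> serve as coordinates on
  \<open>T B\<close>, in which \<open>Phi\<close> merely takes classes.\<close>

lemma T_eq:
  "T B = (\<lambda>(r, s). (r + s, r - s)) ` {(r, s). 0 < s \<and> s < r \<and> r + s < B \<and> odd (r + s)}"
proof (intro equalityI subsetI)
  fix p assume p: "p \<in> T B"
  obtain d1 d2 where d: "p = (d1, d2)" by (cases p)
  have o: "odd d1" "odd d2" "0 < d2" "d2 < d1" "d1 < B" using p by (auto simp: d T_def X_def)
  then obtain i j where "d1 = 2 * i + 1" "d2 = 2 * j + 1" by (meson oddE)
  then show "p \<in> (\<lambda>(r, s). (r + s, r - s)) ` {(r, s). 0 < s \<and> s < r \<and> r + s < B \<and> odd (r + s)}"
    using o d by (intro image_eqI[where x = "(i + j + 1, i - j)"]) auto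
qed (auto simp: T_def X_def)

lemma Phi_sum_diff: "Phi B (r + s, r - s) = {iclass B r, iclass B s}"
  by (simp add: Phi_def)

text \<open>A class has two representatives \<open>x\<close> and \<open>B - x\<close> of opposite
  parity. The bounds \<open>s < r\<close> and \<open>r + s < B\<close> force \<open>s\<close> to be
  the least of all four representatives of the two classes; the parity of \<open>r + s\<close> then
  selects \<open>r\<close>.\<close>

lemma bij_betw_Phi:
  assumes "B > 1" "odd B"
  shows "bij_betw (Phi B) (T B) (nsets (P B) 2)"
proof -
  have inj: "inj_on (Phi B) (T B)"
  proof (rule inj_onI)
    fix p q assume p: "p \<in> T B" and q: "q \<in> T B" and eq: "Phi B p = Phi B q"
    obtain r s where r: "p = (r + s, r - s)" "0 < s" "s < r" "r + s < B" "odd (r + s)"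
      using p by (auto simp: T_eq)
    obtain r' s' where r': "q = (r' + s', r' - s')" "0 < s'" "s' < r'" "r' + s' < B" "odd (r' + s')"
      using q by (auto simp: T_eq)
    have e: "iclass B x = iclass B y \<longleftrightarrow> x = y \<or> x + y = B"
      if "x \<in> {r, s}" "y \<in> {r', s'}" for x y
      using that r r' by (intro iclass_eq_iff_small) auto
    have "(iclass B r = iclass B r' \<and> iclass B s = iclass B s') \<or>
          (iclass B r = iclass B s' \<and> iclass B s = iclass B r')"
      using eq by (simp add: r(1) r'(1) Phi_sum_diff doubleton_eq_iff)
    then have "((r = r' \<or> r + r' = B) \<and> (s = s' \<or> s + s' = B)) \<or>
               ((r = s' \<or> r + s' = B) \<and> (s = r' \<or> s + r' = B))"
      by (simp add: e)
    \<comment> \<open>Each of \<open>r\<close> and \<open>r'\<close> lies strictly between its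
      partner and the complement of that partner, which rules out the crossed matching;
      \<open>s + s' = B\<close> fails because both are below \<open>B/2\<close>.\<close>
    then have "s = s' \<and> (r = r' \<or> r + r' = B)" using r r' by linarith
    moreover have "r + r' \<noteq> B" if "s = s'" using that r(5) r'(5) assms(2) by auto
    ultimately show "p = q" by (auto simp: r(1) r'(1))
  qed
  have "Phi B p \<in> nsets (P B) 2" if p: "p \<in> T B" for p
  proof -
    obtain r s where r: "p = (r + s, r - s)" "0 < s" "s < r" "r + s < B"
      using p by (auto simp: T_eq)
    have "iclass B r \<in> P B" "iclass B s \<in> P B" "iclass B r \<noteq> iclass B s"
      using r assms by (auto intro!: iclass_in_P simp: iclass_eq_iff_small)
    then show ?thesis by (auto simp: r(1) Phi_sum_diff nsets_2_iff)
  qed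
  moreover have "S \<in> Phi B ` T B" if S: "S \<in> nsets (P B) 2" for S
  proof -
    obtain x y where xy: "0 < x" "2 * x < B" "0 < y" "2 * y < B"
      "iclass B x \<noteq> iclass B y" "S = {iclass B x, iclass B y}"
      using S assms by (auto simp: nsets_2_iff P_eq)
    then obtain i j where ij: "0 < i" "i < j" "2 * j < B" "S = {iclass B i, iclass B j}"
      by (metis linorder_neqE_linordered_idom insert_commute)
    \<comment> \<open>Both \<open>j\<close> and \<open>B - j\<close> satisfy the bounds, and exactly
      one of them has parity opposite to \<open>i\<close>.\<close>
    have "\<exists>r. iclass B r = iclass B j \<and> i < r \<and> r + i < B \<and> odd (r + i)"
    proof (cases "odd (i + j)")
      case True
      then show ?thesis using ij by (intro exI[of _ j]) (auto simp: add.commute)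
    next
      case False
      then show ?thesis
        using ij assms by (intro exI[of _ "B - j"]) (auto simp: iclass_eq_iff)
    qed
    then obtain r where r: "iclass B r = iclass B j" "i < r" "r + i < B" "odd (r + i)" by blast
    have "S = Phi B (r + i, r - i)" using ij r by (auto simp: Phi_sum_diff)
    moreover have "(r + i, r - i) \<in> T B" using ij r by (auto simp: T_eq)
    ultimately show ?thesis by blast
  qed
  ultimately show ?thesis using inj by (auto simp: bij_betw_def)
qed

section \<open>Conjugacy with doubling\<close>

text \<open>Swapping negates the half-difference, which is exact for odd entries. With the sign
  rules below, this removes the absolute values, \<open>max\<close> and \<open>min\<close> from the
  formula for \<open>K\<close>.\<close>

lemma Phi_swap:
  assumes "B > 1" "odd x" "odd y"
  shows "Phi B (y, x) = Phi B (x, y)"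
proof -
  have "(y - x) div 2 = - ((x - y) div 2)" using assms(2,3) by presburger
  then show ?thesis using assms(1) by (simp add: Phi_def iclass_uminus add.commute)
qed

lemma Phi_uminus_snd: "Phi B (x, - y) = Phi B (x, y)"
  by (simp add: Phi_def insert_commute)

lemma Phi_uminus_fst:
  assumes "B > 1" "odd x" "odd y"
  shows "Phi B (- x, y) = Phi B (x, y)"
  using assms by (metis Phi_swap Phi_uminus_snd even_minus)

lemma Phi_K:
  assumes "odd B" "p \<in> T B"
  shows "Phi B (K B p) = delta B (Phi B p)"
proof -
  obtain r s where r: "p = (r + s, r - s)" "0 < s" "s < r" "r + s < B" "odd (r + s)"
    using assms(2) by (auto simp: T_eq)
  have B: "B > 1" using r by linarith
  define x where "x = 2 * (r + s) - B"
  define y where "y = 2 * (r - s) - B"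
  have o: "odd x" "odd y" using assms(1) by (auto simp: x_def y_def)
  \<comment> \<open>As \<open>x - y = 4 s\<close> and \<open>x + y = 2 (2 r - B)\<close>, neither
    \<open>x = y\<close> nor \<open>x = - y\<close> can occur.\<close>
  have "2 * r \<noteq> B" using assms(1) by auto
  then have "\<bar>x\<bar> \<noteq> \<bar>y\<bar>" using r by (auto simp: x_def y_def abs_if)
  then have K: "K B p = (max \<bar>x\<bar> \<bar>y\<bar>, min \<bar>x\<bar> \<bar>y\<bar>)"
    using K_pos[of "r + s" "r - s" B] r assms by (auto simp: T_def x_def y_def)
  have "Phi B (K B p) = Phi B (\<bar>x\<bar>, \<bar>y\<bar>)"
    using o B by (auto simp: K max_def min_def Phi_swap)
  also have "\<dots> = Phi B (x, y)"
    using o B by (auto simp: abs_if Phi_uminus_fst Phi_uminus_snd)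
  also have "\<dots> = {iclass B (2 * r - B), iclass B (2 * s)}"
  proof -
    \<comment> \<open>The half-sum of \<open>x\<close> and \<open>y\<close> is
      \<open>2 r - B\<close> and the half-difference is \<open>2 s\<close>: doubling up to a
      multiple of \<open>B\<close>.\<close>
    have "(x, y) = ((2 * r - B) + 2 * s, (2 * r - B) - 2 * s)" by (simp add: x_def y_def)
    then show ?thesis by (simp only: Phi_sum_diff)
  qed
  also have "iclass B (2 * r - B) = iclass B (2 * r)" using B by (simp add: iclass_eq_iff)
  finally show ?thesis using delta_pair[OF B] by (simp add: r(1) Phi_sum_diff)
qed

theorem theorem1p1:
  fixes B :: int
  assumes "B > 3" and "odd B"
  shows "(K B ` T B \<subseteq> T B \<and> (K B ^^ 3) ` X B \<subseteq> T B) \<and>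
         (delta B ` nsets (P B) 2 \<subseteq> nsets (P B) 2 \<and>
          bij_betw (Phi B) (T B) (nsets (P B) 2) \<and>
          (\<forall>p\<in>T B. Phi B (K B p) = delta B (Phi B p)))"
proof -
  have KT: "K B ` T B \<subseteq> T B" using K_T assms(2) by blast
  have K3: "(K B ^^ 3) ` X B \<subseteq> T B"
    using K_cubed_in_T assms by (auto simp: eval_nat_numeral)
  have bij: "bij_betw (Phi B) (T B) (nsets (P B) 2)" using bij_betw_Phi assms by simp
  have conj: "\<forall>p\<in>T B. Phi B (K B p) = delta B (Phi B p)" using Phi_K assms(2) by blast
  have nsets: "nsets (P B) 2 = Phi B ` T B" using bij by (simp add: bij_betw_def)
  \<comment> \<open>That \<open>delta\<close> preserves two-element sets is inherited from the
    invariance of \<open>T B\<close> through the conjugacy, since \<open>Phi\<close> is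
    onto.\<close>
  have "delta B ` nsets (P B) 2 = Phi B ` K B ` T B"
    unfolding nsets image_image by (rule image_cong) (use conj in auto)
  also have "\<dots> \<subseteq> Phi B ` T B" using KT by (rule image_mono)
  also note nsets[symmetric]
  finally show ?thesis using KT K3 bij conj by blast
qed

end
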